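(* Let $A$ be a Prüfer domain with quotient field $F \ne A$. Then $\mathrm{Max}\,A$ is a Noetherian space (in the Zariski topology) if and only if $A$ satisfies $(\#\#)$.
   Context: $\mathrm{Max}\,A$ is the set of maximal ideals of $A$ with the subspace topology from $\mathrm{Spec}\,A$. A space is Noetherian if its open sets satisfy the ascending chain condition. A Prüfer domain $B$ with quotient field $F \neq B$ satisfies $(\#)$ if for each maximal ideal $M$ of $B$, $B_M$ is irredundant in the representation $\{B_N : N \in \mathrm{Max}\,B\}$ of $B$, i.e. $\bigcap_{N \in \mathrm{Max}\,B,\ N \neq M} B_N \neq B$ (an empty intersection is $F$). A Prüfer domain $A$ satisfies $(\#\#)$ if every overring $B$ of $A$ (ring with $A \subseteq B \subseteq F$), $B \neq F$, satisfies $(\#)$. *)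

theory Defs
  imports "HOL-Algebra.Algebra" "HOL-Analysis.Abstract_Topology"
begin

section \<open>The Zariski topology\<close>

definition spectrum :: "('a, 'b) ring_scheme \<Rightarrow> 'a set set" where
  "spectrum R = {P. primeideal P R}"

definition max_spectrum :: "('a, 'b) ring_scheme \<Rightarrow> 'a set set" where
  "max_spectrum R = {M. maximalideal M R}"

definition vanishing_set :: "('a, 'b) ring_scheme \<Rightarrow> 'a set \<Rightarrow> 'a set set" where
  "vanishing_set R E = {P \<in> spectrum R. E \<subseteq> P}"

definition zariski_topology :: "('a, 'b) ring_scheme \<Rightarrow> 'a set topology" where
  "zariski_topology R =
     topology (\<lambda>U. \<exists>E \<subseteq> carrier R. U = spectrum R - vanishing_set R E)"

definition max_topology :: "('a, 'b) ring_scheme \<Rightarrow> 'a set topology" where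
  "max_topology R = subtopology (zariski_topology R) (max_spectrum R)"

definition noetherian_space :: "'a topology \<Rightarrow> bool" where
  "noetherian_space \<T> \<longleftrightarrow>
     (\<forall>U :: nat \<Rightarrow> 'a set.
        (\<forall>n. openin \<T> (U n)) \<and> (\<forall>n. U n \<subseteq> U (Suc n)) \<longrightarrow> (\<exists>n. \<forall>m \<ge> n. U m = U n))"

lemma istopology_zariski:
  "istopology (\<lambda>U. \<exists>E \<subseteq> carrier R. U = spectrum R - vanishing_set R E)"
  unfolding istopology_def
proof (intro conjI allI impI)
  fix S T
  assume "\<exists>E \<subseteq> carrier R. S = spectrum R - vanishing_set R E"
    and "\<exists>E \<subseteq> carrier R. T = spectrum R - vanishing_set R E"
  then obtain D E where D: "D \<subseteq> carrier R" "S = spectrum R - vanishing_set R D"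
    and E: "E \<subseteq> carrier R" "T = spectrum R - vanishing_set R E"
    by blast
  define H where "H = {d \<otimes>\<^bsub>R\<^esub> e | d e. d \<in> D \<and> e \<in> E} \<inter> carrier R"
  have "H \<subseteq> P \<longleftrightarrow> D \<subseteq> P \<or> E \<subseteq> P" if "P \<in> spectrum R" for P
  proof -
    interpret primeideal P R using that by (simp add: spectrum_def)
    show ?thesis
    proof
      assume H: "H \<subseteq> P"
      show "D \<subseteq> P \<or> E \<subseteq> P"
      proof (rule ccontr)
        assume "\<not> (D \<subseteq> P \<or> E \<subseteq> P)"
        then obtain d e where "d \<in> D" "d \<notin> P" "e \<in> E" "e \<notin> P" by blast
        with H I_prime[of d e] D(1) E(1) show False by (auto simp: H_def)
      qed
    next
      assume "D \<subseteq> P \<or> E \<subseteq> P"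
      then show "H \<subseteq> P"
        using D(1) E(1) I_l_closed I_r_closed unfolding H_def by blast
    qed
  qed
  then have "S \<inter> T = spectrum R - vanishing_set R H"
    unfolding D E vanishing_set_def by blast
  moreover have "H \<subseteq> carrier R" by (simp add: H_def)
  ultimately show "\<exists>E \<subseteq> carrier R. S \<inter> T = spectrum R - vanishing_set R E" by blast
next
  fix \<K>
  assume "\<forall>K \<in> \<K>. \<exists>E \<subseteq> carrier R. K = spectrum R - vanishing_set R E"
  then obtain E where E: "\<And>K. K \<in> \<K> \<Longrightarrow> E K \<subseteq> carrier R"
    "\<And>K. K \<in> \<K> \<Longrightarrow> K = spectrum R - vanishing_set R (E K)"
    by metis
  have "\<Union>\<K> = (\<Union>K \<in> \<K>. spectrum R - vanishing_set R (E K))"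
    using E(2) by auto
  also have "\<dots> = spectrum R - vanishing_set R (\<Union>K \<in> \<K>. E K)"
    unfolding vanishing_set_def by auto
  finally show "\<exists>E \<subseteq> carrier R. \<Union>\<K> = spectrum R - vanishing_set R E"
    using E(1) by (metis UN_least)
qed

lemma openin_zariski_topology:
  "openin (zariski_topology R) U \<longleftrightarrow>
     (\<exists>E \<subseteq> carrier R. U = spectrum R - vanishing_set R E)"
  unfolding zariski_topology_def by (simp add: topology_inverse' istopology_zariski)

lemma topspace_zariski_topology: "topspace (zariski_topology R) = spectrum R"
proof
  show "topspace (zariski_topology R) \<subseteq> spectrum R"
    by (auto simp: topspace_def openin_zariski_topology)
  have "\<not> carrier R \<subseteq> P" if "P \<in> spectrum R" for P
  proof -
    interpret primeideal P R using that by (simp add: spectrum_def)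
    show ?thesis using I_notcarr a_subset by blast
  qed
  then have "vanishing_set R (carrier R) = {}"
    by (auto simp: vanishing_set_def)
  then have "openin (zariski_topology R) (spectrum R)"
    unfolding openin_zariski_topology by blast
  then show "spectrum R \<subseteq> topspace (zariski_topology R)"
    by (rule openin_subset)
qed

lemma topspace_max_topology:
  assumes "cring R"
  shows "topspace (max_topology R) = max_spectrum R"
  using cring.maximalideal_prime[OF assms]
  by (auto simp: max_topology_def topspace_zariski_topology spectrum_def max_spectrum_def)

section \<open>Domains inside their quotient field\<close>

text \<open>
  A domain is given as a subring \<open>A\<close> of its quotient field \<open>F\<close>, so that overrings and
  localizations are again subsets of \<open>F\<close>. As a ring in its own right it is \<open>F\<lparr>carrier := A\<rparr>\<close>.
\<close>

locale domain_in_quotient_field = field F + subring A F for A and F (structure) +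
  assumes fraction: "x \<in> carrier F \<Longrightarrow> \<exists>a \<in> A. \<exists>s \<in> A - {\<zero>}. x = a \<otimes> inv s"

definition fractional_inverse :: "('a, 'b) ring_scheme \<Rightarrow> 'a set \<Rightarrow> 'a set \<Rightarrow> 'a set" where
  "fractional_inverse F A I = {x \<in> carrier F. \<forall>i \<in> I. x \<otimes>\<^bsub>F\<^esub> i \<in> A}"

text \<open>
  In the following, \<open>ideal_prod F\<close> forms all finite sums of products of elements of its arguments,
  which need not be ideals of \<open>F\<close>.
\<close>

definition invertible_ideal :: "('a, 'b) ring_scheme \<Rightarrow> 'a set \<Rightarrow> 'a set \<Rightarrow> bool" where
  "invertible_ideal F A I \<longleftrightarrow> ideal_prod F I (fractional_inverse F A I) = A"

locale prufer_domain = domain_in_quotient_field +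
  assumes invertible: "\<lbrakk>S \<subseteq> A; finite S; I = genideal (F\<lparr>carrier := A\<rparr>) S; I \<noteq> {\<zero>}\<rbrakk>
    \<Longrightarrow> invertible_ideal F A I"

definition localization :: "('a, 'b) ring_scheme \<Rightarrow> 'a set \<Rightarrow> 'a set \<Rightarrow> 'a set" where
  "localization F B P = {b \<otimes>\<^bsub>F\<^esub> inv\<^bsub>F\<^esub> s | b s. b \<in> B \<and> s \<in> B - P}"

definition overring :: "('a, 'b) ring_scheme \<Rightarrow> 'a set \<Rightarrow> 'a set \<Rightarrow> bool" where
  "overring F A B \<longleftrightarrow> subring B F \<and> A \<subseteq> B"

section \<open>The conditions (#) and (##)\<close>

text \<open>The intersection with \<open>carrier F\<close> only makes the empty intersection equal to \<open>F\<close>.\<close>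

definition sharp :: "('a, 'b) ring_scheme \<Rightarrow> 'a set \<Rightarrow> bool" where
  "sharp F B \<longleftrightarrow>
     (\<forall>M \<in> max_spectrum (F\<lparr>carrier := B\<rparr>).
        carrier F \<inter> (\<Inter>N \<in> max_spectrum (F\<lparr>carrier := B\<rparr>) - {M}. localization F B N) \<noteq> B)"

definition double_sharp :: "('a, 'b) ring_scheme \<Rightarrow> 'a set \<Rightarrow> bool" where
  "double_sharp F A \<longleftrightarrow> (\<forall>B. overring F A B \<and> B \<noteq> carrier F \<longrightarrow> sharp F B)"

end

theory Submission
  imports Defs
begin

text \<open>
  \<open>Max A\<close> is Noetherian iff every ideal \<open>J\<close> of \<open>A\<close> contains a finite set \<open>S\<close> such that the
  maximal ideals containing \<open>S\<close> already contain \<open>J\<close>.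

  If this holds and \<open>N\<close> is a maximal ideal of an overring \<open>B\<close>, take such an \<open>S\<close> for \<open>J = N \<inter> A\<close>.
  As localizations of \<open>A\<close> at maximal ideals are valuation rings, no other maximal ideal \<open>N'\<close> of \<open>B\<close>
  contains \<open>S\<close>, so the inverse of the ideal \<open>(S)\<close> lies in every \<open>B\<^sub>N'\<close>. If the intersection of
  these were \<open>B\<close>, then \<open>1 \<in> (S)(S)\<^sup>-\<^sup>1 \<subseteq> N\<close>.

  Conversely, an ideal \<open>P\<close> maximal among those violating the condition is prime. Let \<open>B\<close> be the
  intersection of the \<open>A\<^sub>M\<close> over the maximal ideals \<open>M\<close> not containing \<open>P\<close>. Denominator ideals in a
  Pruefer domain are finitely generated, so \<open>B \<subseteq> A\<^sub>P\<close>, and by maximality of \<open>P\<close> a maximal ideal \<open>N\<close>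
  of \<open>B\<close> over \<open>P\<close> satisfies \<open>N \<inter> A = P\<close>. Each of the \<open>M\<close> lies under some \<open>N' \<noteq> N\<close>, hence
  already the \<open>B\<^sub>N'\<close> with \<open>N' \<noteq> N\<close> intersect in \<open>B\<close>, contradicting (#).
\<close>

section \<open>Noetherian maximal spectra\<close>

lemma (in ring) chain_Union_ideal:
  assumes "\<C> \<noteq> {}" "subset.chain {I. ideal I R \<and> \<Phi> I} \<C>"
  shows "ideal (\<Union>\<C>) R"
proof -
  have "subset.chain {I. ideal I R} \<C>"
    using assms(2) by (auto simp: subset.chain_def)
  from chain_Union_is_ideal[OF this] show ?thesis using assms(1) by simp
qed

text \<open>Zorn's lemma on the proper ideals above \<open>I\<close>; properness in the form
  \<open>\<one> \<notin> J\<close> passes directly to unions of chains.\<close>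

lemma (in cring) exists_maximalideal:
  assumes "ideal I R" "\<one> \<notin> I"
  shows "\<exists>M. maximalideal M R \<and> I \<subseteq> M"
proof -
  let ?X = "{J. ideal J R \<and> I \<subseteq> J \<and> \<one> \<notin> J}"
  have "\<exists>M\<in>?X. \<forall>J\<in>?X. M \<subseteq> J \<longrightarrow> J = M"
  proof (rule subset_Zorn_nonempty)
    show "?X \<noteq> {}" using assms by blast
    fix \<C> assume C: "\<C> \<noteq> {}" "subset.chain ?X \<C>"
    have "ideal (\<Union>\<C>) R" by (rule chain_Union_ideal[OF C])
    then show "\<Union>\<C> \<in> ?X" using C by (auto simp: subset.chain_def)
  qed
  then obtain M where M: "ideal M R" "I \<subseteq> M" "\<one> \<notin> M"
    and max: "\<And>J. ideal J R \<Longrightarrow> I \<subseteq> J \<Longrightarrow> \<one> \<notin> J \<Longrightarrow> M \<subseteq> J \<Longrightarrow> J = M"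
    by auto
  have "maximalideal M R"
  proof (rule maximalidealI[OF M(1)])
    show "carrier R \<noteq> M" using M(3) by auto
    fix J assume J: "ideal J R" "M \<subseteq> J" "J \<subseteq> carrier R"
    show "J = M \<or> J = carrier R"
      using max[OF J(1) _ _ J(2)] J(2) M(2) ideal.one_imp_carrier[OF J(1)] by blast
  qed
  with M(2) show ?thesis by blast
qed

section \<open>Finite support and the ascending chain condition on \<open>Max\<close>\<close>

text \<open>Finite generation up to Jacobson radicals: \<open>J\<close> and \<open>S\<close> cut out
  the same closed subset of \<open>Max\<close>.\<close>

definition finitely_max_supported :: "('a, 'b) ring_scheme \<Rightarrow> 'a set \<Rightarrow> bool" where
  "finitely_max_supported R J \<longleftrightarrow>
     (\<exists>S \<subseteq> J. finite S \<and> (\<forall>M \<in> max_spectrum R. S \<subseteq> M \<longrightarrow> J \<subseteq> M))"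

lemma finitely_max_supportedE:
  assumes "finitely_max_supported R J"
  obtains S where "S \<subseteq> J" "finite S" "\<And>M. M \<in> max_spectrum R \<Longrightarrow> S \<subseteq> M \<Longrightarrow> J \<subseteq> M"
proof -
  obtain S where "S \<subseteq> J \<and> finite S \<and> (\<forall>M \<in> max_spectrum R. S \<subseteq> M \<longrightarrow> J \<subseteq> M)"
    using assms unfolding finitely_max_supported_def by (rule exE)
  then show thesis by (intro that[of S]) simp_all
qed

lemma finitely_max_supportedI:
  assumes "S \<subseteq> J" "finite S" "\<And>M. M \<in> max_spectrum R \<Longrightarrow> S \<subseteq> M \<Longrightarrow> J \<subseteq> M"
  shows "finitely_max_supported R J"
  unfolding finitely_max_supported_def using assms by (intro exI[of _ S]) simp

lemma not_finitely_max_supportedE: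
  assumes "\<not> finitely_max_supported R J" "S \<subseteq> J" "finite S"
  obtains M x where "M \<in> max_spectrum R" "S \<subseteq> M" "x \<in> J" "x \<notin> M"
  using finitely_max_supportedI[OF assms(2,3), of R] assms(1) by (meson subsetI)

lemma openin_max_topology:
  assumes "cring R"
  shows "openin (max_topology R) U \<longleftrightarrow>
    (\<exists>E \<subseteq> carrier R. U = {M \<in> max_spectrum R. \<not> E \<subseteq> M})"
proof -
  have "max_spectrum R \<subseteq> spectrum R"
    using cring.maximalideal_prime[OF assms] by (auto simp: spectrum_def max_spectrum_def)
  then have "(spectrum R - vanishing_set R E) \<inter> max_spectrum R = {M \<in> max_spectrum R. \<not> E \<subseteq> M}" for E
    by (auto simp: vanishing_set_def)
  then show ?thesis
    unfolding max_topology_def openin_subtopology openin_zariski_topology by metis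
qed

lemma max_spectrumD:
  assumes "M \<in> max_spectrum R"
  shows "maximalideal M R" "ideal M R" "\<one>\<^bsub>R\<^esub> \<notin> M"
proof -
  show M: "maximalideal M R" using assms by (simp add: max_spectrum_def)
  then show I: "ideal M R" by (rule maximalideal.axioms)
  show "\<one>\<^bsub>R\<^esub> \<notin> M"
    using maximalideal.I_notcarr[OF M] ideal.one_imp_carrier[OF I] by blast
qed

lemma noetherian_spaceD:
  assumes "noetherian_space T" "\<And>n. openin T (U n)" "\<And>n. U n \<subseteq> U (Suc n)"
  obtains n where "U (Suc n) = U n"
proof -
  have "\<exists>n. \<forall>m\<ge>n. U m = U n"
    using assms(1)[unfolded noetherian_space_def, rule_format, of U] assms(2,3) by simp
  then obtain n where "\<forall>m\<ge>n. U m = U n" ..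
  then have "U (Suc n) = U n" using le_SucI[OF order_refl] by blast
  then show thesis by (rule that)
qed

text \<open>Without a finite \<open>S\<close>, elements of \<open>J\<close> can be chosen one after
  another, each missing from some maximal ideal that contains all earlier ones. The open sets they
  define then increase strictly forever.\<close>

lemma noetherian_max_topologyD:
  assumes "cring R" "noetherian_space (max_topology R)" "J \<subseteq> carrier R"
  shows "finitely_max_supported R J"
proof (rule ccontr)
  let ?V = "\<lambda>S. {M \<in> max_spectrum R. \<not> S \<subseteq> M}"
  assume n: "\<not> finitely_max_supported R J"
  have ex: "\<exists>x. x \<in> J \<and> (\<exists>M \<in> max_spectrum R. S \<subseteq> M \<and> x \<notin> M)"
    if S: "S \<subseteq> J" "finite S" for S
    using not_finitely_max_supportedE[OF n S] by metis
  define f where "f S = (SOME x. x \<in> J \<and> (\<exists>M \<in> max_spectrum R. S \<subseteq> M \<and> x \<notin> M))" for S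
  have f: "f S \<in> J" "\<exists>M \<in> max_spectrum R. S \<subseteq> M \<and> f S \<notin> M"
    if "S \<subseteq> J" "finite S" for S
    using someI_ex[OF ex[OF that]] unfolding f_def by blast+
  define S where "S = rec_nat {} (\<lambda>_ T. insert (f T) T)"
  have S_Suc: "S (Suc n) = insert (f (S n)) (S n)" for n by (simp add: S_def)
  have S: "S n \<subseteq> J \<and> finite (S n)" for n
    by (induction n) (use f(1) in \<open>auto simp: S_def\<close>)
  have "openin (max_topology R) (?V (S n))" for n
    unfolding openin_max_topology[OF assms(1)]
    using S[of n] assms(3) by (intro exI[of _ "S n"]) auto
  moreover have "?V (S n) \<subseteq> ?V (S (Suc n))" for n by (auto simp: S_Suc)
  ultimately obtain n where eq: "?V (S (Suc n)) = ?V (S n)"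
    by (rule noetherian_spaceD[OF assms(2), of "\<lambda>n. ?V (S n)"])
  obtain M where M: "M \<in> max_spectrum R" "S n \<subseteq> M" "f (S n) \<notin> M"
    using f(2)[of "S n"] S[of n] by auto
  then have "M \<in> ?V (S (Suc n))" by (simp add: S_Suc)
  then have "M \<in> ?V (S n)" by (simp only: eq)
  then show False using M(2) by simp
qed

text \<open>The chain of open sets is traded for a chain of ideals. A finite set supporting the
  union of the ideals lies in one of them, and from there on the open sets are constant.\<close>

lemma noetherian_max_topologyI:
  assumes "cring R" and supp: "\<And>J. ideal J R \<Longrightarrow> finitely_max_supported R J"
  shows "noetherian_space (max_topology R)"
  unfolding noetherian_space_def
proof (intro allI impI, elim conjE)
  interpret cring R by fact
  fix U :: "nat \<Rightarrow> 'a set set"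
  assume op: "\<forall>n. openin (max_topology R) (U n)" and mono: "\<forall>n. U n \<subseteq> U (Suc n)"
  have U_mono: "U m \<subseteq> U n" if "m \<le> n" for m n
    using that
  proof (rule lift_Suc_mono_le[of U, rotated])
    show "U k \<subseteq> U (Suc k)" for k using mono ..
  qed
  have "\<forall>n. \<exists>E. E \<subseteq> carrier R \<and> U n = {M \<in> max_spectrum R. \<not> E \<subseteq> M}"
    using op unfolding openin_max_topology[OF assms(1)] .
  then have "\<exists>E. \<forall>n. E n \<subseteq> carrier R \<and> U n = {M \<in> max_spectrum R. \<not> E n \<subseteq> M}"
    by (rule choice)
  then obtain E where "\<forall>n. E n \<subseteq> carrier R \<and> U n = {M \<in> max_spectrum R. \<not> E n \<subseteq> M}" ..
  then have E: "E n \<subseteq> carrier R" "U n = {M \<in> max_spectrum R. \<not> E n \<subseteq> M}" for n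
    by simp_all
  \<comment> \<open>The largest subset of \<open>R\<close> that defines \<open>U n\<close>. Unlike
    the arbitrarily chosen \<open>E n\<close>, these sets are sure to increase with
    \<open>n\<close>. If \<open>U n\<close> is all of \<open>Max\<close>, the result is the whole
    ring.\<close>
  define J where "J n = {a \<in> carrier R. \<forall>M \<in> max_spectrum R. M \<notin> U n \<longrightarrow> a \<in> M}" for n
  have J_ideal: "ideal (J n) R" for n
  proof -
    have eq: "J n = \<Inter>(insert (carrier R) (max_spectrum R - U n))"
      by (auto simp: J_def)
    show ?thesis unfolding eq
      by (rule i_Intersect) (auto simp: oneideal dest: max_spectrumD)
  qed
  have J_mono: "J m \<subseteq> J n" if "m \<le> n" for m n
    using U_mono[OF that] by (auto simp: J_def)
  have "subset.chain {I. ideal I R} (range J)"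
    unfolding subset_chain_def
  proof (intro conjI ballI)
    show "range J \<subseteq> {I. ideal I R}" using J_ideal by auto
    fix V W assume "V \<in> range J" "W \<in> range J"
    then obtain m n where "V = J m" "W = J n" by blast
    then show "V \<subseteq> W \<or> W \<subseteq> V" using J_mono[of m n] J_mono[of n m] nle_le[of m n] by blast
  qed
  from chain_Union_is_ideal[OF this] have "ideal (\<Union>(range J)) R" by simp
  from supp[OF this] obtain S where S: "S \<subseteq> \<Union>(range J)" "finite S"
    "\<And>M. M \<in> max_spectrum R \<Longrightarrow> S \<subseteq> M \<Longrightarrow> \<Union>(range J) \<subseteq> M"
    by (rule finitely_max_supportedE) blast
  have "\<exists>n. S \<subseteq> J n"
    using S(2,1)
  proof (induction S)
    case (insert x T)
    then obtain m n where "T \<subseteq> J m" "x \<in> J n" by auto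
    then have "insert x T \<subseteq> J (max m n)"
      using J_mono[of m "max m n"] J_mono[of n "max m n"] by auto
    then show ?case by blast
  qed auto
  then obtain n where n: "S \<subseteq> J n" by blast
  \<comment> \<open>A maximal ideal in \<open>U m\<close> does not contain
    \<open>E m \<subseteq> J m\<close>, so it misses an element of \<open>S \<subseteq> J n\<close>;
    every maximal ideal outside \<open>U n\<close> contains \<open>J n\<close>.\<close>
  have "U m \<subseteq> U n" for m
  proof
    fix M assume M: "M \<in> U m"
    then have Mm: "M \<in> max_spectrum R" and "\<not> E m \<subseteq> M" using E(2) by auto
    moreover have "E m \<subseteq> J m" using E by (auto simp: J_def)
    ultimately have "\<not> S \<subseteq> M" using S(3) by blast
    then obtain s where "s \<in> S" "s \<notin> M" by blast
    then show "M \<in> U n" using n Mm by (auto simp: J_def)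
  qed
  then show "\<exists>n. \<forall>m\<ge>n. U m = U n" using U_mono by blast
qed

section \<open>Primality of ideals maximal without finite support\<close>

text \<open>The ideal sum \<open>P + (a)\<close> is spelled out elementwise because the primality
  argument multiplies elements of two such sums.\<close>

lemma (in cring) ideal_plus_principal:
  assumes "ideal P R" "a \<in> carrier R"
  defines "J \<equiv> {p \<oplus> r \<otimes> a | p r. p \<in> P \<and> r \<in> carrier R}"
  shows "ideal J R" "P \<subseteq> J" "a \<in> J"
proof -
  interpret P: ideal P R by fact
  have "J = P <+>\<^bsub>R\<^esub> (PIdl a)"
    unfolding J_def cgenideal_def set_add_def set_mult_def by auto
  then show "ideal J R" using add_ideals assms(1,2) cgenideal_ideal by simp
  show "P \<subseteq> J"
  proof
    fix p assume p: "p \<in> P"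
    then have "p = p \<oplus> \<zero> \<otimes> a" using P.Icarr assms(2) by simp
    then show "p \<in> J" unfolding J_def using p by blast
  qed
  have "a = \<zero> \<oplus> \<one> \<otimes> a" using assms(2) by simp
  then show "a \<in> J" unfolding J_def using P.zero_closed by blast
qed

text \<open>As in Cohen's theorem, an ideal maximal among those violating a finiteness condition
  is prime.\<close>

lemma (in cring) exists_prime_not_finitely_max_supported:
  assumes "ideal I R" "\<not> finitely_max_supported R I"
  obtains P where "primeideal P R" "\<not> finitely_max_supported R P"
    "\<And>J. ideal J R \<Longrightarrow> P \<subset> J \<Longrightarrow> finitely_max_supported R J"
proof -
  let ?X = "{J. ideal J R \<and> \<not> finitely_max_supported R J}"
  have "\<exists>M\<in>?X. \<forall>J\<in>?X. M \<subseteq> J \<longrightarrow> J = M"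
  proof (rule subset_Zorn_nonempty)
    show "?X \<noteq> {}" using assms by blast
    fix \<C> assume C: "\<C> \<noteq> {}" "subset.chain ?X \<C>"
    \<comment> \<open>A finite \<open>S\<close> inside the union lies in one member of the chain and
      would support that member too.\<close>
    have "\<not> finitely_max_supported R (\<Union>\<C>)"
    proof
      assume "finitely_max_supported R (\<Union>\<C>)"
      then obtain S where S: "S \<subseteq> \<Union>\<C>" "finite S"
        "\<And>M. M \<in> max_spectrum R \<Longrightarrow> S \<subseteq> M \<Longrightarrow> \<Union>\<C> \<subseteq> M"
        by (rule finitely_max_supportedE) blast
      obtain J where "J \<in> \<C>" "S \<subseteq> J"
        using finite_subset_Union_chain[OF S(2,1) C(1,2)] by blast
      then have "finitely_max_supported R J"
        using S(2,3) by (intro finitely_max_supportedI[of S]) blast+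
      then show False using C(2) \<open>J \<in> \<C>\<close> by (auto simp: subset.chain_def)
    qed
    then show "\<Union>\<C> \<in> ?X" using chain_Union_ideal[OF C] by simp
  qed
  then obtain P where P: "ideal P R" "\<not> finitely_max_supported R P"
    and max: "\<And>J. ideal J R \<Longrightarrow> P \<subseteq> J \<Longrightarrow> \<not> finitely_max_supported R J \<Longrightarrow> J = P"
    by auto
  interpret P: ideal P R by fact
  have "primeideal P R"
  proof (rule primeidealI[OF P(1) is_cring])
    \<comment> \<open>The unit ideal is supported by \<open>{\<one>}\<close>, vacuously: no maximal
      ideal contains \<open>\<one>\<close>.\<close>
    show "carrier R \<noteq> P"
    proof
      assume "carrier R = P"
      then have "finitely_max_supported R P"
        using max_spectrumD(3)[of _ R] by (intro finitely_max_supportedI[of "{\<one>}"]) auto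
      then show False using P(2) by contradiction
    qed
    fix a b assume ab: "a \<in> carrier R" "b \<in> carrier R" "a \<otimes> b \<in> P"
    show "a \<in> P \<or> b \<in> P"
    proof (rule ccontr)
      assume n: "\<not> (a \<in> P \<or> b \<in> P)"
      let ?J = "\<lambda>a. {p \<oplus> r \<otimes> a | p r. p \<in> P \<and> r \<in> carrier R}"
      have supp: "finitely_max_supported R (?J c)" if "c \<in> carrier R" "c \<notin> P" for c
        using ideal_plus_principal[OF P(1) that(1)] max that(2) by blast
      obtain S where S: "S \<subseteq> ?J a" "finite S" "\<And>M. M \<in> max_spectrum R \<Longrightarrow> S \<subseteq> M \<Longrightarrow> ?J a \<subseteq> M"
        using finitely_max_supportedE[OF supp[of a]] ab(1) n by blast
      obtain T where T: "T \<subseteq> ?J b" "finite T" "\<And>M. M \<in> max_spectrum R \<Longrightarrow> T \<subseteq> M \<Longrightarrow> ?J b \<subseteq> M"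
        using finitely_max_supportedE[OF supp[of b]] ab(2) n by blast
      \<comment> \<open>Products of the supports of \<open>P + (a)\<close> and
        \<open>P + (b)\<close> lie in \<open>P\<close> because \<open>a \<otimes> b\<close> does. A
        maximal ideal containing all of them contains one of the two supports, by primality, so
        \<open>W\<close> would support \<open>P\<close>.\<close>
      define W where "W = (\<lambda>(s, t). s \<otimes> t) ` (S \<times> T)"
      have "finite W" using S(2) T(2) by (simp add: W_def)
      moreover have "W \<subseteq> P"
      proof
        fix w assume "w \<in> W"
        then obtain p r q u where w: "w = (p \<oplus> r \<otimes> a) \<otimes> (q \<oplus> u \<otimes> b)"
          and pq: "p \<in> P" "q \<in> P" and ru: "r \<in> carrier R" "u \<in> carrier R"
          using S(1) T(1) unfolding W_def by fast
        have pq': "p \<in> carrier R" "q \<in> carrier R" using pq P.Icarr by auto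
        have "w = p \<otimes> (q \<oplus> u \<otimes> b) \<oplus> ((r \<otimes> a) \<otimes> q \<oplus> (r \<otimes> u) \<otimes> (a \<otimes> b))"
          unfolding w using pq' ru ab(1,2) by algebra
        also have "\<dots> \<in> P"
          using P.I_r_closed[OF pq(1), of "q \<oplus> u \<otimes> b"] P.I_l_closed[OF pq(2), of "r \<otimes> a"]
            P.I_l_closed[OF ab(3), of "r \<otimes> u"] pq' ru ab(1,2)
            additive_subgroup.a_closed[OF P.additive_subgroup_axioms] by simp
        finally show "w \<in> P" .
      qed
      moreover have "P \<subseteq> M" if M: "M \<in> max_spectrum R" "W \<subseteq> M" for M
      proof -
        interpret M: primeideal M R
          using maximalideal_prime[OF max_spectrumD(1)[OF M(1)]] .
        have J_carr: "?J c \<subseteq> carrier R" if "c \<in> carrier R" for c using P.Icarr that by auto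
        have "S \<subseteq> M \<or> T \<subseteq> M"
        proof (rule ccontr)
          assume "\<not> (S \<subseteq> M \<or> T \<subseteq> M)"
          then obtain s t where st: "s \<in> S" "s \<notin> M" "t \<in> T" "t \<notin> M" by blast
          then have "s \<otimes> t \<in> M" using M(2) by (auto simp: W_def)
          moreover have "s \<in> carrier R" "t \<in> carrier R"
            using st S(1) T(1) J_carr ab(1,2) by blast+
          ultimately show False using M.I_prime st by blast
        qed
        then show ?thesis
          using S(3)[OF M(1)] T(3)[OF M(1)] ideal_plus_principal(2)[OF P(1) ab(1)]
            ideal_plus_principal(2)[OF P(1) ab(2)] by blast
      qed
      ultimately have "finitely_max_supported R P"
        by (intro finitely_max_supportedI[of W])
      then show False using P(2) by contradiction
    qed
  qed
  with P max that show thesis by blast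
qed

section \<open>Overrings of Pruefer domains\<close>

lemma ideal_in_subringD:
  assumes "ideal N (F\<lparr>carrier := B\<rparr>)"
  shows "N \<subseteq> B" "\<zero>\<^bsub>F\<^esub> \<in> N"
    "\<And>x y. x \<in> N \<Longrightarrow> y \<in> N \<Longrightarrow> x \<oplus>\<^bsub>F\<^esub> y \<in> N"
    "\<And>b x. b \<in> B \<Longrightarrow> x \<in> N \<Longrightarrow> b \<otimes>\<^bsub>F\<^esub> x \<in> N"
    "\<And>b x. b \<in> B \<Longrightarrow> x \<in> N \<Longrightarrow> x \<otimes>\<^bsub>F\<^esub> b \<in> N"
proof -
  interpret N: ideal N "F\<lparr>carrier := B\<rparr>" by fact
  show "N \<subseteq> B" using N.Icarr by auto
  show "\<zero>\<^bsub>F\<^esub> \<in> N" using additive_subgroup.zero_closed[OF N.additive_subgroup_axioms] by simp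
  show "x \<oplus>\<^bsub>F\<^esub> y \<in> N" if "x \<in> N" "y \<in> N" for x y 
    using additive_subgroup.a_closed[OF N.additive_subgroup_axioms that] by simp
  show "b \<otimes>\<^bsub>F\<^esub> x \<in> N" "x \<otimes>\<^bsub>F\<^esub> b \<in> N" if "b \<in> B" "x \<in> N" for b x
    using N.I_l_closed[of x b] N.I_r_closed[of x b] that by simp_all
qed

context field
begin

lemma subring_cring:
  assumes "subring B R"
  shows "cring (R\<lparr>carrier := B\<rparr>)"
  using subring_is_domain[OF assms] by (rule domain.axioms)

text \<open>Closure under negation comes from multiplication by
  \<open>\<ominus> \<one> \<in> B\<close>.\<close>

lemma ideal_in_subringI:
  assumes B: "subring B R" and N: "N \<subseteq> B" "\<zero> \<in> N"
    and add: "\<And>x y. x \<in> N \<Longrightarrow> y \<in> N \<Longrightarrow> x \<oplus> y \<in> N"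
    and mult: "\<And>b x. b \<in> B \<Longrightarrow> x \<in> N \<Longrightarrow> b \<otimes> x \<in> N"
  shows "ideal N (R\<lparr>carrier := B\<rparr>)"
proof -
  interpret B: cring "R\<lparr>carrier := B\<rparr>" by (rule subring_cring[OF B])
  have carr: "x \<in> carrier R" if "x \<in> B" for x using that subringE(1)[OF B] by blast
  have minus: "\<ominus> x \<in> N" if "x \<in> N" for x
  proof -
    have x: "x \<in> carrier R" using that N(1) carr by blast
    have "(\<ominus> \<one>) \<otimes> x \<in> N" using mult that subringE(3,5)[OF B] by blast
    then show ?thesis using x by (simp add: l_minus)
  qed
  have inv_eq: "inv\<^bsub>add_monoid (R\<lparr>carrier := B\<rparr>)\<^esub> x = \<ominus> x" if "x \<in> B" for x
  proof -
    have "\<ominus>\<^bsub>R\<lparr>carrier := B\<rparr>\<^esub> x = \<ominus> x"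
      using B.minus_equality[of "\<ominus> x" x] that carr subringE(5)[OF B] l_neg by simp
    then show ?thesis by (simp add: a_inv_def)
  qed
  have "subgroup N (add_monoid (R\<lparr>carrier := B\<rparr>))"
    by (rule subgroup.intro) (use N add minus inv_eq in auto)
  then show ?thesis
  proof (rule idealI[OF B.ring_axioms])
    fix a x assume "a \<in> N" "x \<in> carrier (R\<lparr>carrier := B\<rparr>)"
    then have ax: "x \<otimes> a \<in> N" "x \<in> carrier R" "a \<in> carrier R" using mult N(1) carr by auto
    then show "x \<otimes>\<^bsub>R\<lparr>carrier := B\<rparr>\<^esub> a \<in> N" "a \<otimes>\<^bsub>R\<lparr>carrier := B\<rparr>\<^esub> x \<in> N"
      using m_comm[of a x] by simp_all
  qed
qed

lemma max_spectrum_subringD: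
  assumes "subring B R" "N \<in> max_spectrum (R\<lparr>carrier := B\<rparr>)"
  shows "ideal N (R\<lparr>carrier := B\<rparr>)" "N \<subseteq> B" "\<one> \<notin> N" "primeideal N (R\<lparr>carrier := B\<rparr>)"
    "\<And>J. ideal J (R\<lparr>carrier := B\<rparr>) \<Longrightarrow> N \<subseteq> J \<Longrightarrow> \<one> \<notin> J \<Longrightarrow> J = N"
proof -
  note M = max_spectrumD[OF assms(2)]
  show "ideal N (R\<lparr>carrier := B\<rparr>)" by (rule M)
  then show "N \<subseteq> B" by (rule ideal_in_subringD)
  show "\<one> \<notin> N" using M(3) by simp
  show "primeideal N (R\<lparr>carrier := B\<rparr>)"
    by (rule cring.maximalideal_prime[OF subring_cring[OF assms(1)] M(1)])
  show "J = N" if J: "ideal J (R\<lparr>carrier := B\<rparr>)" "N \<subseteq> J" "\<one> \<notin> J" for J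
    using maximalideal.I_maximal[OF M(1) J(1,2)] ideal_in_subringD(1)[OF J(1)] J(3)
      subringE(3)[OF assms(1)] by auto
qed

lemma primeideal_subringD:
  assumes "primeideal P (R\<lparr>carrier := B\<rparr>)" "a \<in> B" "b \<in> B" "a \<otimes> b \<in> P"
  shows "a \<in> P \<or> b \<in> P"
  using primeideal.I_prime[OF assms(1)] assms(2-) by simp

text \<open>Clearing a denominator: \<open>\<zero> \<in> P\<close> makes every
  \<open>s \<in> B - P\<close> a unit of the field.\<close>

lemma mem_localization_iff:
  assumes B: "subring B R" and P: "\<zero> \<in> P"
  shows "x \<in> localization R B P \<longleftrightarrow> x \<in> carrier R \<and> (\<exists>s \<in> B - P. s \<otimes> x \<in> B)"
proof
  have carr: "x \<in> carrier R" if "x \<in> B" for x using that subringE(1)[OF B] by blast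
  show "x \<in> carrier R \<and> (\<exists>s \<in> B - P. s \<otimes> x \<in> B)" if x: "x \<in> localization R B P"
  proof -
    obtain b s where x: "x = b \<otimes> inv s" and b: "b \<in> B" and s: "s \<in> B" "s \<notin> P"
      using x unfolding localization_def by blast
    have u: "s \<in> Units R" using s P carr field_Units by auto
    then have "s \<otimes> x = b"
      using x carr[OF b] carr[OF s(1)] by (metis Units_inv_closed Units_r_inv m_lcomm r_one)
    then have "s \<otimes> x \<in> B" using b by simp
    then show ?thesis using x b s carr u by auto
  qed
  show "x \<in> localization R B P" if x: "x \<in> carrier R \<and> (\<exists>s \<in> B - P. s \<otimes> x \<in> B)"
  proof -
    obtain s where x: "x \<in> carrier R" and s: "s \<in> B" "s \<notin> P" "s \<otimes> x \<in> B" using x by blast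
    have "s \<in> Units R" using s P carr field_Units by auto
    then have "x = (s \<otimes> x) \<otimes> inv s"
      using x carr[OF s(1)] by (metis Units_inv_closed Units_l_inv m_comm m_assoc l_one m_closed)
    then show ?thesis unfolding localization_def using s by blast
  qed
qed

lemma subset_localization:
  assumes B: "subring B R" and P: "\<zero> \<in> P" "\<one> \<notin> P"
  shows "B \<subseteq> localization R B P"
proof
  fix x assume x: "x \<in> B"
  then have "x \<in> carrier R" using subringE(1)[OF B] by blast
  moreover have "\<one> \<in> B - P" using P subringE(3)[OF B] by simp
  moreover have "\<one> \<otimes> x \<in> B" using x calculation(1) by simp
  ultimately show "x \<in> localization R B P" using mem_localization_iff[OF B P(1)] by blast
qed

lemma subring_localization:
  assumes B: "subring B R" and P: "primeideal P (R\<lparr>carrier := B\<rparr>)"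
  shows "subring (localization R B P) R"
proof -
  interpret P: primeideal P "R\<lparr>carrier := B\<rparr>" by fact
  have P0: "\<zero> \<in> P" and P1: "\<one> \<notin> P"
    using ideal_in_subringD(2)[OF P.is_ideal] P.one_imp_carrier P.I_notcarr by auto
  note iff = mem_localization_iff[OF B P0]
  note sub = subset_localization[OF B P0 P1]
  have carr: "x \<in> carrier R" if "x \<in> B" for x using that subringE(1)[OF B] by blast
  have prod: "s \<otimes> t \<in> B - P" if "s \<in> B - P" "t \<in> B - P" for s t
    using primeideal_subringD[OF P] subringE(6)[OF B] that by blast
  show ?thesis
  proof (rule subringI)
    show "localization R B P \<subseteq> carrier R" using iff by blast
    show "\<one> \<in> localization R B P" using sub subringE(3)[OF B] by blast
    show "\<ominus> x \<in> localization R B P" if x: "x \<in> localization R B P" for x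
    proof -
      obtain s where s: "x \<in> carrier R" "s \<in> B - P" "s \<otimes> x \<in> B" using x iff by blast
      then have "s \<otimes> (\<ominus> x) \<in> B" using subringE(5)[OF B s(3)] carr by (simp add: r_minus)
      then show ?thesis using iff s by blast
    qed
    fix x y assume "x \<in> localization R B P" "y \<in> localization R B P"
    then obtain s t where s: "x \<in> carrier R" "s \<in> B - P" "s \<otimes> x \<in> B"
      and t: "y \<in> carrier R" "t \<in> B - P" "t \<otimes> y \<in> B" using iff by blast
    have st: "s \<in> carrier R" "t \<in> carrier R" using s t carr by auto
    have "(s \<otimes> t) \<otimes> (x \<otimes> y) = (s \<otimes> x) \<otimes> (t \<otimes> y)" using s t st by algebra
    moreover have "(s \<otimes> t) \<otimes> (x \<oplus> y) = t \<otimes> (s \<otimes> x) \<oplus> s \<otimes> (t \<otimes> y)" using s t st by algebra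
    ultimately have "(s \<otimes> t) \<otimes> (x \<otimes> y) \<in> B" "(s \<otimes> t) \<otimes> (x \<oplus> y) \<in> B"
      using s t subringE(6,7)[OF B] by auto
    then show "x \<otimes> y \<in> localization R B P" "x \<oplus> y \<in> localization R B P"
      using iff prod s t by (meson a_closed m_closed)+
  qed
qed

text \<open>The maximal ideal of the localization contracts to a proper ideal of \<open>B\<close>,
  and \<open>N\<close> is any maximal ideal above it. The second conclusion lets elements of
  \<open>B\<close> outside \<open>N\<close> be recognized as units of the localization.\<close>

lemma exists_max_over_center:
  assumes A: "subring A R" and B: "subring B R" and P: "primeideal P (R\<lparr>carrier := A\<rparr>)"
    and AB: "A \<subseteq> B" and BP: "B \<subseteq> localization R A P"
  obtains N where "N \<in> max_spectrum (R\<lparr>carrier := B\<rparr>)"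
    "\<And>x s. x \<in> B \<Longrightarrow> s \<in> A - P \<Longrightarrow> s \<otimes> x \<in> P \<Longrightarrow> x \<in> N"
    "P \<subseteq> N"
proof -
  interpret P: primeideal P "R\<lparr>carrier := A\<rparr>" by fact
  note Pd = ideal_in_subringD[OF P.is_ideal]
  have P1: "\<one> \<notin> P" using P.one_imp_carrier P.I_notcarr by auto
  have carrA: "x \<in> carrier R" if "x \<in> A" for x using that subringE(1)[OF A] by blast
  have carrB: "x \<in> carrier R" if "x \<in> B" for x using that subringE(1)[OF B] by blast
  have prod: "s \<otimes> t \<in> A - P" if "s \<in> A - P" "t \<in> A - P" for s t
    using primeideal_subringD[OF P] subringE(6)[OF A] that by blast
  \<comment> \<open>the contraction to \<open>B\<close> of the maximal ideal of the localization of \<open>A\<close> at \<open>P\<close>\<close>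
  define Q where "Q = {x \<in> B. \<exists>s \<in> A - P. s \<otimes> x \<in> P}"
  have PQ: "P \<subseteq> Q"
  proof
    fix x assume x: "x \<in> P"
    then have "\<one> \<otimes> x \<in> P" using Pd(1) carrA by auto
    then show "x \<in> Q" unfolding Q_def using x Pd(1) AB P1 subringE(3)[OF A] by blast
  qed
  have "ideal Q (R\<lparr>carrier := B\<rparr>)"
  proof (rule ideal_in_subringI[OF B])
    show "Q \<subseteq> B" by (auto simp: Q_def)
    show "\<zero> \<in> Q" using PQ Pd(2) by blast
  next
    fix x y assume "x \<in> Q" "y \<in> Q"
    then obtain s t where s: "x \<in> B" "s \<in> A - P" "s \<otimes> x \<in> P"
      and t: "y \<in> B" "t \<in> A - P" "t \<otimes> y \<in> P" by (auto simp: Q_def)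
    have c: "s \<in> carrier R" "t \<in> carrier R" "x \<in> carrier R" "y \<in> carrier R"
      using s t carrA carrB by auto
    have "(s \<otimes> t) \<otimes> (x \<oplus> y) = t \<otimes> (s \<otimes> x) \<oplus> s \<otimes> (t \<otimes> y)" using c by algebra
    also have "\<dots> \<in> P" using s t Pd(3)[OF Pd(4) Pd(4)] by blast
    finally show "x \<oplus> y \<in> Q"
      unfolding Q_def using prod[OF s(2) t(2)] subringE(7)[OF B s(1) t(1)] by blast
  next
    fix b x assume b: "b \<in> B" and "x \<in> Q"
    then obtain s where s: "x \<in> B" "s \<in> A - P" "s \<otimes> x \<in> P" by (auto simp: Q_def)
    obtain t where t: "t \<in> A - P" "t \<otimes> b \<in> A"
      using b BP mem_localization_iff[OF A Pd(2)] by blast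
    have c: "s \<in> carrier R" "t \<in> carrier R" "x \<in> carrier R" "b \<in> carrier R"
      using s t b carrA carrB by auto
    have "(s \<otimes> t) \<otimes> (b \<otimes> x) = (t \<otimes> b) \<otimes> (s \<otimes> x)" using c by algebra
    also have "\<dots> \<in> P" using s t Pd(4) by blast
    finally show "b \<otimes> x \<in> Q"
      unfolding Q_def using prod[OF s(2) t(1)] subringE(6)[OF B b s(1)] by blast
  qed
  moreover have "\<one> \<notin> Q"
    using carrA by (auto simp: Q_def)
  ultimately obtain N where "maximalideal N (R\<lparr>carrier := B\<rparr>)" "Q \<subseteq> N"
    using cring.exists_maximalideal[OF subring_cring[OF B], of Q] by auto
  then show thesis
  proof (intro that[of N])
    show "N \<in> max_spectrum (R\<lparr>carrier := B\<rparr>)"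
      using \<open>maximalideal N (R\<lparr>carrier := B\<rparr>)\<close> by (simp add: max_spectrum_def)
    show "x \<in> N" if "x \<in> B" "s \<in> A - P" "s \<otimes> x \<in> P" for x s
      using that \<open>Q \<subseteq> N\<close> unfolding Q_def by blast
    show "P \<subseteq> N" using PQ \<open>Q \<subseteq> N\<close> by blast
  qed
qed

end

section \<open>Invertibility and valuations in a Pruefer domain\<close>

context prufer_domain
begin

lemma A_subring: "subring A F"
  by (rule subring_axioms)

lemma A_carr: "x \<in> A \<Longrightarrow> x \<in> carrier F"
  using subringE(1)[OF A_subring] by blast

text \<open>Invertibility of the ideal generated by \<open>S\<close>, without mention of that ideal.\<close>

lemma one_mem_of_inverse_products:
  assumes S: "S \<subseteq> A" "finite S" and s0: "s0 \<in> S" "s0 \<noteq> \<zero>"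
    and add: "\<And>x y. x \<in> H \<Longrightarrow> y \<in> H \<Longrightarrow> x \<oplus> y \<in> H"
    and prod: "\<And>s y. s \<in> S \<Longrightarrow> y \<in> fractional_inverse F A S \<Longrightarrow> s \<otimes> y \<in> H"
  shows "\<one> \<in> H"
proof -
  interpret R: cring "F\<lparr>carrier := A\<rparr>" by (rule subring_cring[OF A_subring])
  let ?D = "fractional_inverse F A S"
  define I where "I = genideal (F\<lparr>carrier := A\<rparr>) S"
  have SI: "S \<subseteq> I" using R.genideal_self S(1) by (simp add: I_def)
  then have I0: "I \<noteq> {\<zero>}" using s0 by blast
  have "invertible_ideal F A I" using invertible[OF S I_def I0] .
  then have one: "\<one> \<in> ideal_prod F I (fractional_inverse F A I)"
    using subringE(3)[OF A_subring] by (simp add: invertible_ideal_def)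
  have D_I: "fractional_inverse F A I \<subseteq> ?D" using SI by (auto simp: fractional_inverse_def)
  \<comment> \<open>The multipliers from \<open>A\<close> that carry the inverse of \<open>S\<close>
    into \<open>H\<close>. They form an ideal containing \<open>S\<close>, hence containing
    \<open>I\<close>.\<close>
  define K where "K = {i \<in> A. \<forall>y \<in> ?D. i \<otimes> y \<in> H}"
  have D_mult: "a \<otimes> y \<in> ?D" if a: "a \<in> A" and y: "y \<in> ?D" for a y
  proof -
    have y': "y \<in> carrier F" "\<And>s. s \<in> S \<Longrightarrow> y \<otimes> s \<in> A"
      using y by (auto simp: fractional_inverse_def)
    have "(a \<otimes> y) \<otimes> s \<in> A" if "s \<in> S" for s
      using y' that a subringE(6)[OF A_subring] m_assoc A_carr S(1) by auto
    then show ?thesis using y'(1) A_carr[OF a] by (auto simp: fractional_inverse_def)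
  qed
  have "ideal K (F\<lparr>carrier := A\<rparr>)"
  proof (rule ideal_in_subringI[OF A_subring])
    show "K \<subseteq> A" by (auto simp: K_def)
    \<comment> \<open>\<open>H\<close> is only assumed closed under sums of its members, so
      \<open>\<zero> \<in> H\<close> is obtained as the product of \<open>s0\<close> and
      \<open>\<zero>\<close>.\<close>
    have "\<zero> \<in> ?D" using S(1) A_carr subringE(2)[OF A_subring]
      by (auto simp: fractional_inverse_def)
    from prod[OF s0(1) this] have "\<zero> \<in> H" using s0(1) S(1) A_carr by auto
    then show "\<zero> \<in> K" using subringE(2)[OF A_subring] by (auto simp: K_def fractional_inverse_def)
  next
    fix x y assume "x \<in> K" "y \<in> K"
    then show "x \<oplus> y \<in> K"
      using add subringE(7)[OF A_subring] A_carr
      by (auto simp: K_def fractional_inverse_def l_distr)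
  next
    fix b x assume b: "b \<in> A" and x: "x \<in> K"
    have "(b \<otimes> x) \<otimes> y \<in> H" if y: "y \<in> ?D" for y
    proof -
      have "y \<in> carrier F" "x \<in> carrier F" "b \<in> carrier F"
        using y x b A_carr by (auto simp: K_def fractional_inverse_def)
      then have "(b \<otimes> x) \<otimes> y = x \<otimes> (b \<otimes> y)" by algebra
      then show ?thesis using x D_mult[OF b y] by (simp add: K_def)
    qed
    then show "b \<otimes> x \<in> K" using b x subringE(6)[OF A_subring] by (auto simp: K_def)
  qed
  then have IK: "I \<subseteq> K"
    unfolding I_def using S(1) prod by (intro R.genideal_minimal) (auto simp: K_def)
  from one show ?thesis
  proof (induction rule: ideal_prod.induct)
    case (prod i j)
    then show ?case using IK D_I by (auto simp: K_def)
  next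
    case (sum x y)
    then show ?case using add by blast
  qed
qed

text \<open>Invertibility of the ideal \<open>(a, b)\<close>: its inverse is closed under addition,
  so a sum of products collapses to one term for \<open>a\<close> and one for
  \<open>b\<close>.\<close>

lemma two_generated_inverse:
  assumes "a \<in> A" "b \<in> A" "b \<noteq> \<zero>"
  obtains u v where "u \<in> carrier F" "v \<in> carrier F" "a \<otimes> u \<in> A" "b \<otimes> u \<in> A"
    "a \<otimes> v \<in> A" "b \<otimes> v \<in> A" "a \<otimes> u \<oplus> b \<otimes> v = \<one>"
proof -
  let ?D = "fractional_inverse F A {a, b}"
  define H where "H = {a \<otimes> u \<oplus> b \<otimes> v | u v. u \<in> ?D \<and> v \<in> ?D}"
  have ab: "a \<in> carrier F" "b \<in> carrier F" using assms A_carr by auto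
  have D: "u \<in> carrier F" "a \<otimes> u \<in> A" "b \<otimes> u \<in> A" if "u \<in> ?D" for u
    using that ab by (auto simp: fractional_inverse_def m_comm)
  have D0: "\<zero> \<in> ?D" using ab subringE(2)[OF A_subring] by (auto simp: fractional_inverse_def)
  have D_add: "u \<oplus> v \<in> ?D" if "u \<in> ?D" "v \<in> ?D" for u v
    using that ab subringE(7)[OF A_subring] by (auto simp: fractional_inverse_def l_distr)
  have "\<one> \<in> H"
  proof (rule one_mem_of_inverse_products[of "{a, b}" b])
    fix x y assume "x \<in> H" "y \<in> H"
    then obtain u v u' v' where x: "x = a \<otimes> u \<oplus> b \<otimes> v" "y = a \<otimes> u' \<oplus> b \<otimes> v'"
      and uv: "u \<in> ?D" "v \<in> ?D" "u' \<in> ?D" "v' \<in> ?D" by (auto simp: H_def)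
    have "x \<oplus> y = a \<otimes> (u \<oplus> u') \<oplus> b \<otimes> (v \<oplus> v')"
      unfolding x using uv[THEN D(1)] ab by algebra
    then show "x \<oplus> y \<in> H" unfolding H_def using uv D_add by blast
  next
    fix s y assume s: "s \<in> {a, b}" and y: "y \<in> ?D"
    have "a \<otimes> y = a \<otimes> y \<oplus> b \<otimes> \<zero>" "b \<otimes> y = a \<otimes> \<zero> \<oplus> b \<otimes> y" using ab D(1)[OF y] by auto
    then show "s \<otimes> y \<in> H" unfolding H_def using s y D0 by blast
  qed (use assms in auto)
  then obtain u v where "u \<in> ?D" "v \<in> ?D" "a \<otimes> u \<oplus> b \<otimes> v = \<one>" by (auto simp: H_def)
  then show thesis using that[of u v] D by auto
qed

text \<open>The localization at \<open>M\<close> is a valuation ring: it contains \<open>c / b\<close> or \<open>b / c\<close>.\<close>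

lemma localization_valuation:
  assumes M: "M \<in> max_spectrum (F\<lparr>carrier := A\<rparr>)"
    and b: "b \<in> carrier F" "b \<noteq> \<zero>" and c: "c \<in> carrier F" "c \<noteq> \<zero>"
  obtains s a where "s \<in> A - M" "a \<in> A" "s \<otimes> c = a \<otimes> b \<or> s \<otimes> b = a \<otimes> c"
proof -
  note Md = max_spectrum_subringD[OF A_subring M]
  \<comment> \<open>The ratio \<open>b / c\<close> is replaced by a fraction \<open>p / q\<close> of
    elements of \<open>A\<close>, to which invertibility applies.\<close>
  have "\<exists>p \<in> A. \<exists>q \<in> A - {\<zero>}. q \<otimes> b = p \<otimes> c"
  proof -
    have "b \<otimes> inv c \<in> carrier F" using b c by (simp add: field_Units)
    then obtain p q where pq: "p \<in> A" "q \<in> A - {\<zero>}" "b \<otimes> inv c = p \<otimes> inv q"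
      using fraction by meson
    have u: "q \<in> Units F" "c \<in> Units F" using pq A_carr c by (auto simp: field_Units)
    have p: "p \<in> carrier F" "q \<in> carrier F" using pq A_carr by auto
    have ic: "inv c \<in> carrier F" "inv q \<in> carrier F" "c \<otimes> inv c = \<one>" "q \<otimes> inv q = \<one>"
      using u by auto
    have "q \<otimes> b = (c \<otimes> inv c) \<otimes> (q \<otimes> b)" using ic p b by simp
    also have "\<dots> = (b \<otimes> inv c) \<otimes> (q \<otimes> c)" using ic(1,2) p b c by algebra
    also have "\<dots> = (p \<otimes> c) \<otimes> (q \<otimes> inv q)" unfolding pq(3) using ic(1,2) p b c by algebra
    also have "\<dots> = p \<otimes> c" using ic p c by simp
    finally show ?thesis using pq by blast
  qed
  then obtain p q where pq: "p \<in> A" "q \<in> A" "q \<noteq> \<zero>" "q \<otimes> b = p \<otimes> c" by blast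
  obtain u v where uv: "u \<in> carrier F" "v \<in> carrier F" "p \<otimes> u \<in> A" "q \<otimes> u \<in> A"
    "p \<otimes> v \<in> A" "q \<otimes> v \<in> A" "p \<otimes> u \<oplus> q \<otimes> v = \<one>"
    using two_generated_inverse[OF pq(1-3)] .
  have pq': "p \<in> carrier F" "q \<in> carrier F" using pq A_carr by auto
  \<comment> \<open>The two terms add up to \<open>\<one>\<close>, so one of them avoids
    \<open>M\<close>; that one serves as \<open>s\<close>.\<close>
  have "p \<otimes> u \<notin> M \<or> q \<otimes> v \<notin> M"
    using ideal_in_subringD(3)[OF Md(1)] uv(7) Md(3) by metis
  moreover have "(p \<otimes> u) \<otimes> c = (q \<otimes> u) \<otimes> b"
  proof -
    have "(p \<otimes> u) \<otimes> c = u \<otimes> (p \<otimes> c)" using pq' uv c by algebra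
    also have "\<dots> = u \<otimes> (q \<otimes> b)" using pq(4) by simp
    also have "\<dots> = (q \<otimes> u) \<otimes> b" using pq' uv(1) b(1) by algebra
    finally show ?thesis .
  qed
  moreover have "(q \<otimes> v) \<otimes> b = (p \<otimes> v) \<otimes> c"
  proof -
    have "(q \<otimes> v) \<otimes> b = v \<otimes> (q \<otimes> b)" using pq' uv(2) b(1) by algebra
    also have "\<dots> = v \<otimes> (p \<otimes> c)" using pq(4) by simp
    also have "\<dots> = (p \<otimes> v) \<otimes> c" using pq' uv(2) c(1) by algebra
    finally show ?thesis .
  qed
  ultimately show thesis using that uv by blast
qed

section \<open>Maximal ideals of overrings and their contractions\<close>

lemma contraction_ideal:
  assumes B: "subring B F" "A \<subseteq> B" and N: "ideal N (F\<lparr>carrier := B\<rparr>)"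
  shows "ideal (N \<inter> A) (F\<lparr>carrier := A\<rparr>)"
proof (rule ideal_in_subringI[OF A_subring])
  note Nd = ideal_in_subringD[OF N]
  show "N \<inter> A \<subseteq> A" "\<zero> \<in> N \<inter> A" using Nd(2) subringE(2)[OF A_subring] by auto
  show "x \<oplus> y \<in> N \<inter> A" if "x \<in> N \<inter> A" "y \<in> N \<inter> A" for x y
    using that Nd(3) subringE(7)[OF A_subring] by blast
  show "b \<otimes> x \<in> N \<inter> A" if "b \<in> A" "x \<in> N \<inter> A" for b x
    using that Nd(4) B(2) subringE(6)[OF A_subring] by blast
qed

lemma exists_max_over_contraction:
  assumes B: "subring B F" "A \<subseteq> B" and N: "N \<in> max_spectrum (F\<lparr>carrier := B\<rparr>)"
  obtains M where "M \<in> max_spectrum (F\<lparr>carrier := A\<rparr>)" "N \<inter> A \<subseteq> M"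
proof -
  note Nd = max_spectrum_subringD[OF B(1) N]
  have "\<one>\<^bsub>F\<lparr>carrier := A\<rparr>\<^esub> \<notin> N \<inter> A" using Nd(3) by simp
  from cring.exists_maximalideal[OF subring_cring[OF A_subring] contraction_ideal[OF B Nd(1)] this]
  show thesis using that by (auto simp: max_spectrum_def)
qed

text \<open>Distinct \<open>N\<close> and \<open>N'\<close> have elements \<open>b\<close> in
  \<open>N\<close> only and \<open>c\<close> in \<open>N'\<close> only. Comparing \<open>b\<close>
  and \<open>c\<close> in the valuation ring at \<open>M\<close>, with a denominator outside
  \<open>M\<close> and hence outside both ideals, forces \<open>c \<in> N\<close> or
  \<open>b \<in> N'\<close>.\<close>

lemma max_spectrum_overring_eqI:
  assumes B: "subring B F" "A \<subseteq> B"
    and N: "N \<in> max_spectrum (F\<lparr>carrier := B\<rparr>)" and N': "N' \<in> max_spectrum (F\<lparr>carrier := B\<rparr>)"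
    and M: "M \<in> max_spectrum (F\<lparr>carrier := A\<rparr>)" "N \<inter> A \<subseteq> M" "N' \<inter> A \<subseteq> M"
  shows "N = N'"
proof (rule ccontr)
  note Nd = max_spectrum_subringD[OF B(1) N] and Nd' = max_spectrum_subringD[OF B(1) N']
  note Ni = ideal_in_subringD[OF Nd(1)] and Ni' = ideal_in_subringD[OF Nd'(1)]
  assume "N \<noteq> N'"
  then have "\<not> N \<subseteq> N'" "\<not> N' \<subseteq> N" using Nd(5)[OF Nd'(1)] Nd'(5)[OF Nd(1)] Nd(3) Nd'(3) by auto
  then obtain b c where b: "b \<in> N" "b \<notin> N'" and c: "c \<in> N'" "c \<notin> N" by blast
  have carr: "b \<in> carrier F" "b \<noteq> \<zero>" "c \<in> carrier F" "c \<noteq> \<zero>" "b \<in> B" "c \<in> B"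
    using b c Ni(1,2) Ni'(1,2) subringE(1)[OF B(1)] by auto
  obtain s a where sa: "s \<in> A - M" "a \<in> A" "s \<otimes> c = a \<otimes> b \<or> s \<otimes> b = a \<otimes> c"
    using localization_valuation[OF M(1) carr(1-4)] .
  have s: "s \<in> B" "s \<notin> N" "s \<notin> N'" using sa(1) M(2,3) B(2) by auto
  have aB: "a \<in> B" using sa(2) B(2) by blast
  have "s \<otimes> c \<in> N \<or> s \<otimes> b \<in> N'"
    using sa(3) Ni(4)[OF aB b(1)] Ni'(4)[OF aB c(1)] by metis
  then show False
    using primeideal_subringD[OF Nd(4) s(1) carr(6)] primeideal_subringD[OF Nd'(4) s(1) carr(5)]
      s b c by blast
qed

text \<open>If \<open>N\<close> were zero, \<open>B\<close> would be a field containing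
  \<open>A\<close>, hence all of \<open>F\<close>. A nonzero element of \<open>N\<close> is moved
  into \<open>A\<close> by multiplying with its denominator.\<close>

lemma max_spectrum_overring_nonzero:
  assumes B: "subring B F" "A \<subseteq> B" "B \<noteq> carrier F"
    and N: "N \<in> max_spectrum (F\<lparr>carrier := B\<rparr>)"
  obtains n where "n \<in> N \<inter> A" "n \<noteq> \<zero>"
proof -
  note Nd = max_spectrum_subringD[OF B(1) N]
  note Ni = ideal_in_subringD[OF Nd(1)]
  have "N \<noteq> {\<zero>}"
  proof
    assume "N = {\<zero>}"
    then have "maximalideal {\<zero>\<^bsub>F\<lparr>carrier := B\<rparr>\<^esub>} (F\<lparr>carrier := B\<rparr>)"
      using max_spectrumD(1)[OF N] by simp
    then have "field (F\<lparr>carrier := B\<rparr>)"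
      by (rule cring.zeromaximalideal_fieldI[OF subring_cring[OF B(1)]])
    then have sf: "subfield B F" using subfield_iff(1) subringE(1)[OF B(1)] by blast
    have "x \<in> B" if "x \<in> carrier F" for x
    proof -
      obtain a s where as: "a \<in> A" "s \<in> A - {\<zero>}" "x = a \<otimes> inv s"
        using fraction \<open>x \<in> carrier F\<close> by meson
      then have "inv s \<in> B" using subfield_m_inv(1)[OF sf] B(2) by blast
      then show ?thesis using as B(2) subringE(6)[OF B(1)] by blast
    qed
    then show False using B(3) subringE(1)[OF B(1)] by blast
  qed
  then obtain n where n: "n \<in> N" "n \<noteq> \<zero>" using Ni(2) by blast
  then have nF: "n \<in> carrier F" using Ni(1) subringE(1)[OF B(1)] by blast
  obtain a s where as: "a \<in> A" "s \<in> A - {\<zero>}" "n = a \<otimes> inv s" using fraction[OF nF] by meson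
  have "s \<in> Units F" using as A_carr by (simp add: field_Units)
  then have "s \<otimes> n = a"
    using as A_carr by (metis Units_closed Units_inv_closed Units_r_inv m_lcomm r_one)
  moreover have "s \<otimes> n \<in> N" using Ni(4)[of s n] n(1) as(2) B(2) by blast
  ultimately have sn: "s \<otimes> n \<in> N \<inter> A" using as(1) by simp
  have "s \<otimes> n \<noteq> \<zero>" using integral_iff n nF as A_carr by auto
  with sn show thesis by (rule that)
qed

text \<open>Any element of \<open>S\<close> outside \<open>N\<close> is a common denominator for the
  whole inverse of \<open>S\<close>.\<close>

lemma fractional_inverse_subset_localization:
  assumes B: "subring B F" "A \<subseteq> B" and N: "\<zero> \<in> N" and S: "S \<subseteq> A" "\<not> S \<subseteq> N"
  shows "fractional_inverse F A S \<subseteq> localization F B N"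
proof
  fix y assume y: "y \<in> fractional_inverse F A S"
  obtain s where s: "s \<in> S" "s \<notin> N" using S(2) by blast
  then have "y \<in> carrier F" "y \<otimes> s \<in> A" "s \<in> A" using y S(1) by (auto simp: fractional_inverse_def)
  then have "y \<in> carrier F \<and> s \<otimes> y \<in> B \<and> s \<in> B - N" using B(2) s(2) m_comm A_carr by auto
  then show "y \<in> localization F B N" using mem_localization_iff[OF B(1) N] by blast
qed

section \<open>A Noetherian maximal spectrum implies (##)\<close>

lemma noetherian_imp_double_sharp:
  assumes "noetherian_space (max_topology (F\<lparr>carrier := A\<rparr>))"
  shows "double_sharp F A"
  unfolding double_sharp_def sharp_def
proof (intro allI impI ballI)
  let ?Max = "\<lambda>B. max_spectrum (F\<lparr>carrier := B\<rparr>)"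
  fix B N assume "overring F A B \<and> B \<noteq> carrier F" and N: "N \<in> ?Max B"
  then have B: "subring B F" "A \<subseteq> B" "B \<noteq> carrier F" by (auto simp: overring_def)
  note Nd = max_spectrum_subringD[OF B(1) N]
  note Ni = ideal_in_subringD[OF Nd(1)]
  have "finitely_max_supported (F\<lparr>carrier := A\<rparr>) (N \<inter> A)"
    by (rule noetherian_max_topologyD[OF subring_cring[OF A_subring] assms]) simp
  then obtain S0 where S0: "S0 \<subseteq> N \<inter> A" "finite S0"
    "\<And>M. M \<in> ?Max A \<Longrightarrow> S0 \<subseteq> M \<Longrightarrow> N \<inter> A \<subseteq> M"
    by (rule finitely_max_supportedE) blast
  obtain n where n: "n \<in> N \<inter> A" "n \<noteq> \<zero>" using max_spectrum_overring_nonzero[OF B N] .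
  \<comment> \<open>\<open>S0\<close> might generate the zero ideal; adding \<open>n\<close> makes
    the generated ideal nonzero and so invertible.\<close>
  define S where "S = insert n S0"
  have S: "S \<subseteq> N" "S \<subseteq> A" "finite S" "n \<in> S" using S0 n by (auto simp: S_def)
  let ?L = "carrier F \<inter> (\<Inter>N'\<in>?Max B - {N}. localization F B N')"
  \<comment> \<open>Otherwise a maximal ideal \<open>M\<close> of \<open>A\<close> above
    \<open>N' \<inter> A\<close> contains \<open>S0\<close>, hence also \<open>N \<inter> A\<close>,
    and two maximal ideals of \<open>B\<close> contract into the same \<open>M\<close>.\<close>
  have escape: "\<not> S \<subseteq> N'" if N': "N' \<in> ?Max B" "N' \<noteq> N" for N'
  proof
    assume "S \<subseteq> N'"
    obtain M where M: "M \<in> ?Max A" "N' \<inter> A \<subseteq> M"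
      using exists_max_over_contraction[OF B(1,2) N'(1)] .
    then have "S0 \<subseteq> M" using \<open>S \<subseteq> N'\<close> S(2) by (auto simp: S_def)
    then have "N \<inter> A \<subseteq> M" using S0(3) M(1) by blast
    then show False using max_spectrum_overring_eqI[OF B(1,2) N N'(1) M(1) _ M(2)] N'(2) by blast
  qed
  have inv_L: "fractional_inverse F A S \<subseteq> ?L"
  proof -
    have "fractional_inverse F A S \<subseteq> localization F B N'" if N': "N' \<in> ?Max B" "N' \<noteq> N" for N'
      using fractional_inverse_subset_localization[OF B(1,2) _ S(2) escape[OF N']]
        ideal_in_subringD(2)[OF max_spectrum_subringD(1)[OF B(1) N'(1)]] by blast
    then show ?thesis by (auto simp: fractional_inverse_def)
  qed
  show "?L \<noteq> B"
  proof
    assume "?L = B"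
    then have "fractional_inverse F A S \<subseteq> B" using inv_L by simp
    \<comment> \<open>Taken with \<open>H = N\<close>: elements of \<open>S \<subseteq> N\<close>
      times elements of \<open>B\<close> stay in \<open>N\<close>.\<close>
    then have "\<one> \<in> N"
      using Ni(3,5) S(1) by (intro one_mem_of_inverse_products[OF S(2,3,4) n(2)]) blast+
    then show False using Nd(3) by contradiction
  qed
qed

section \<open>(##) implies finite support of all ideals\<close>

text \<open>If \<open>x\<close> were outside the localization at \<open>P\<close>, its denominator
  ideal would lie in \<open>P\<close>. That ideal has two generators, so some maximal
  \<open>M\<close> contains it but not \<open>P\<close>; yet \<open>x\<close> has a denominator
  outside this \<open>M\<close>.\<close>

lemma subset_localization_of_not_finitely_max_supported:
  assumes P: "primeideal P (F\<lparr>carrier := A\<rparr>)" "\<not> finitely_max_supported (F\<lparr>carrier := A\<rparr>) P"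
    and x: "x \<in> carrier F"
      "\<And>M. M \<in> max_spectrum (F\<lparr>carrier := A\<rparr>) \<Longrightarrow> \<not> P \<subseteq> M \<Longrightarrow> x \<in> localization F A M"
  shows "x \<in> localization F A P"
proof (rule ccontr)
  assume nx: "x \<notin> localization F A P"
  have Pi: "ideal P (F\<lparr>carrier := A\<rparr>)" using P(1) by (rule primeideal.axioms)
  note P0 = ideal_in_subringD(2)[OF Pi]
  have den: "r \<in> P" if "r \<in> A" "r \<otimes> x \<in> A" for r
    using that nx x(1) mem_localization_iff[OF A_subring P0] by blast
  obtain a b where ab: "a \<in> A" "b \<in> A" "b \<noteq> \<zero>" "x = a \<otimes> inv b" using fraction[OF x(1)] by blast
  have ab': "a \<in> carrier F" "b \<in> carrier F" "b \<in> Units F" using ab A_carr by (auto simp: field_Units)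
  have ib: "inv b \<in> carrier F" "b \<otimes> inv b = \<one>" using ab'(3) by auto
  have bx: "b \<otimes> x = a" unfolding ab(4) using ab' ib by (metis m_lcomm r_one)
  obtain u v where uv: "u \<in> carrier F" "v \<in> carrier F" "a \<otimes> u \<in> A" "b \<otimes> u \<in> A"
    "a \<otimes> v \<in> A" "b \<otimes> v \<in> A" "a \<otimes> u \<oplus> b \<otimes> v = \<one>"
    using two_generated_inverse[OF ab(1-3)] .
  \<comment> \<open>Hence \<open>b \<otimes> u\<close> and \<open>b \<otimes> v\<close> are
    denominators of \<open>x\<close>.\<close>
  have "(b \<otimes> w) \<otimes> x = a \<otimes> w" if "w \<in> carrier F" for w
  proof -
    have "(b \<otimes> w) \<otimes> x = (b \<otimes> x) \<otimes> w" using that ab'(1,2) x(1) by algebra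
    then show ?thesis using bx by simp
  qed
  then have "{b \<otimes> u, b \<otimes> v} \<subseteq> P" using den uv by simp
  from not_finitely_max_supportedE[OF P(2) this]
  obtain M z where M0: "M \<in> max_spectrum (F\<lparr>carrier := A\<rparr>)" "{b \<otimes> u, b \<otimes> v} \<subseteq> M"
    "z \<in> P" "z \<notin> M"
    by blast
  then have M: "M \<in> max_spectrum (F\<lparr>carrier := A\<rparr>)" "b \<otimes> u \<in> M" "b \<otimes> v \<in> M" "\<not> P \<subseteq> M"
    by auto
  note Md = max_spectrum_subringD[OF A_subring M(1)]
  note Mi = ideal_in_subringD[OF Md(1)]
  obtain r where r: "r \<in> A" "r \<notin> M" "r \<otimes> x \<in> A"
    using x(2)[OF M(1,4)] mem_localization_iff[OF A_subring Mi(2)] by blast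
  have rF: "r \<in> carrier F" using r A_carr by blast
  \<comment> \<open>The computation writes the denominator \<open>r\<close> as a combination of
    \<open>b \<otimes> u\<close> and \<open>b \<otimes> v\<close> with coefficients
    \<open>r \<otimes> x\<close> and \<open>r\<close> in \<open>A\<close>.\<close>
  have "r = r \<otimes> (a \<otimes> u \<oplus> b \<otimes> v)" using uv(7) rF by simp
  also have "\<dots> = r \<otimes> ((b \<otimes> x) \<otimes> u \<oplus> b \<otimes> v)" using bx by simp
  also have "\<dots> = (r \<otimes> x) \<otimes> (b \<otimes> u) \<oplus> r \<otimes> (b \<otimes> v)"
    using rF x(1) ab'(2) uv(1,2) by algebra
  also have "\<dots> \<in> M" using r M Mi(3)[OF Mi(4) Mi(4)] by blast
  finally show False using r(2) by contradiction
qed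

lemma double_sharp_imp_finitely_max_supported:
  assumes ds: "double_sharp F A" and I: "ideal I (F\<lparr>carrier := A\<rparr>)"
  shows "finitely_max_supported (F\<lparr>carrier := A\<rparr>) I"
proof (rule ccontr)
  let ?Max = "\<lambda>B. max_spectrum (F\<lparr>carrier := B\<rparr>)"
  interpret R: cring "F\<lparr>carrier := A\<rparr>" by (rule subring_cring[OF A_subring])
  assume "\<not> finitely_max_supported (F\<lparr>carrier := A\<rparr>) I"
  from R.exists_prime_not_finitely_max_supported[OF I this]
  obtain P where P: "primeideal P (F\<lparr>carrier := A\<rparr>)" "\<not> finitely_max_supported (F\<lparr>carrier := A\<rparr>) P"
    and P_max: "\<And>J. ideal J (F\<lparr>carrier := A\<rparr>) \<Longrightarrow> P \<subset> J \<Longrightarrow> finitely_max_supported (F\<lparr>carrier := A\<rparr>) J"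
    by blast
  have Pid: "ideal P (F\<lparr>carrier := A\<rparr>)" using P(1) by (rule primeideal.axioms)
  note Pi = ideal_in_subringD[OF Pid]
  note Mi = ideal_in_subringD[OF max_spectrum_subringD(1)[OF A_subring]]
  note Mp = max_spectrum_subringD(4)[OF A_subring]
  define B where "B = {x \<in> carrier F. \<forall>M \<in> ?Max A. \<not> P \<subseteq> M \<longrightarrow> x \<in> localization F A M}"
  have B: "subring B F"
  proof -
    have "B = \<Inter>(insert (carrier F) (localization F A ` {M \<in> ?Max A. \<not> P \<subseteq> M}))"
      by (auto simp: B_def)
    moreover have "subring \<dots> F"
      by (rule subring_Inter)
        (use carrier_is_subring subring_localization[OF A_subring Mp] in auto)
    ultimately show ?thesis by simp
  qed
  have AB: "A \<subseteq> B"
    using subset_localization[OF A_subring Mi(2)] max_spectrum_subringD(3)[OF A_subring] A_carr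
    by (auto simp: B_def)
  have BP: "B \<subseteq> localization F A P"
    using subset_localization_of_not_finitely_max_supported[OF P] by (auto simp: B_def)
  \<comment> \<open>The empty set does not support \<open>P\<close>, so \<open>P\<close> has an
    element outside some maximal ideal, in particular a nonzero one.\<close>
  obtain M0 p where "M0 \<in> ?Max A" "p \<in> P" "p \<notin> M0"
    using not_finitely_max_supportedE[OF P(2) empty_subsetI finite.emptyI] .
  then have p: "p \<in> P" "p \<noteq> \<zero>" using Mi(2) by auto
  have "B \<noteq> carrier F"
  \<comment> \<open>Otherwise \<open>inv p\<close> would lie in the localization at
    \<open>P\<close>, where \<open>p \<in> P\<close> cannot become a unit.\<close>
  proof
    assume "B = carrier F"
    have pu: "p \<in> Units F" using p Pi(1) A_carr by (auto simp: field_Units)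
    then have "inv p \<in> localization F A P" using BP \<open>B = carrier F\<close> by auto
    then obtain s where s: "s \<in> A" "s \<notin> P" "s \<otimes> inv p \<in> A"
      using mem_localization_iff[OF A_subring Pi(2)] by blast
    then have "(s \<otimes> inv p) \<otimes> p \<in> P" using Pi(4) p by blast
    moreover have "(s \<otimes> inv p) \<otimes> p = s"
      using pu A_carr[OF s(1)]
      by (metis Units_closed Units_inv_closed Units_l_inv m_assoc r_one)
    ultimately show False using s(2) by simp
  qed
  then have sharp: "sharp F B" using ds B AB by (auto simp: double_sharp_def overring_def)
  from exists_max_over_center[OF A_subring B P(1) AB BP]
  obtain N where N: "N \<in> ?Max B" "P \<subseteq> N" by metis
  note Nd = max_spectrum_subringD[OF B N(1)]
  note Ni = ideal_in_subringD[OF Nd(1)]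
  \<comment> \<open>A larger contraction has a finite support \<open>T0\<close>. No maximal ideal
    that omits \<open>P\<close> contains \<open>T\<close>, so the inverse of \<open>T\<close> lies
    in \<open>B\<close>; with \<open>T \<subseteq> N\<close>, invertibility gives
    \<open>\<one> \<in> N\<close>.\<close>
  have NP: "N \<inter> A = P"
  proof (rule ccontr)
    assume "N \<inter> A \<noteq> P"
    then have "P \<subset> N \<inter> A" using N(2) Pi(1) by blast
    then have "finitely_max_supported (F\<lparr>carrier := A\<rparr>) (N \<inter> A)"
      by (rule P_max[OF contraction_ideal[OF B AB Nd(1)]])
    then obtain T0 where T0: "T0 \<subseteq> N \<inter> A" "finite T0"
      "\<And>M. M \<in> ?Max A \<Longrightarrow> T0 \<subseteq> M \<Longrightarrow> N \<inter> A \<subseteq> M"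
      by (rule finitely_max_supportedE) blast
    define T where "T = insert p T0"
    have T: "T \<subseteq> N" "T \<subseteq> A" "finite T" "p \<in> T" using T0 p N(2) Pi(1) by (auto simp: T_def)
    have "\<not> T \<subseteq> M" if "M \<in> ?Max A" "\<not> P \<subseteq> M" for M
      using T0(3)[OF that(1)] that(2) \<open>P \<subset> N \<inter> A\<close> by (auto simp: T_def)
    then have "fractional_inverse F A T \<subseteq> B"
      using fractional_inverse_subset_localization[OF A_subring subset_refl Mi(2) T(2)]
      by (auto simp: B_def fractional_inverse_def)
    then have "\<one> \<in> N"
      using Ni(3,5) T(1) by (intro one_mem_of_inverse_products[OF T(2,3,4) p(2)]) blast+
    then show False using Nd(3) by contradiction
  qed
  let ?L = "carrier F \<inter> (\<Inter>N'\<in>?Max B - {N}. localization F B N')"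
  have "B \<subseteq> localization F B N'" if "N' \<in> ?Max B" for N'
    using subset_localization[OF B] ideal_in_subringD(2)[OF max_spectrum_subringD(1)[OF B that]]
      max_spectrum_subringD(3)[OF B that] .
  then have "B \<subseteq> ?L" using subringE(1)[OF B] by auto
  moreover have "?L \<noteq> B" using sharp N(1) by (simp add: sharp_def)
  ultimately obtain y where "y \<in> ?L" "y \<notin> B" by blast
  then have y: "y \<in> carrier F" "y \<notin> B"
    "\<And>N'. N' \<in> ?Max B \<Longrightarrow> N' \<noteq> N \<Longrightarrow> y \<in> localization F B N'" by auto
  then obtain M where M: "M \<in> ?Max A" "\<not> P \<subseteq> M" "y \<notin> localization F A M" by (auto simp: B_def)
  have BM: "B \<subseteq> localization F A M" using M by (auto simp: B_def)
  \<comment> \<open>\<open>B\<close> lies in the localization at \<open>M\<close> by construction,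
    so \<open>M\<close> also lies under a maximal ideal of \<open>B\<close>.\<close>
  obtain N' where N'1: "N' \<in> ?Max B"
    and N'_mem: "\<And>x s. x \<in> B \<Longrightarrow> s \<in> A - M \<Longrightarrow> s \<otimes> x \<in> M \<Longrightarrow> x \<in> N'"
    and N'2: "M \<subseteq> N'"
    by (rule exists_max_over_center[OF A_subring B Mp[OF M(1)] AB BM]) blast
  note N' = N'1 N'2
  \<comment> \<open>Equality would give \<open>M \<subseteq> N \<inter> A = P\<close>, hence
    \<open>P = M\<close> by maximality, although \<open>M\<close> does not contain
    \<open>P\<close>.\<close>
  have "N' \<noteq> N"
  proof
    assume "N' = N"
    then have "M \<subseteq> P" using N'(2) NP Mi(1)[OF M(1)] by blast
    moreover have "\<one> \<notin> P" using NP Nd(3) by blast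
    ultimately have "P = M" using max_spectrum_subringD(5)[OF A_subring M(1) Pid] by blast
    then show False using M(2) by blast
  qed
  then have "y \<in> localization F B N'" using y(3) N'(1) by blast
  then obtain s where s: "s \<in> B" "s \<notin> N'" "s \<otimes> y \<in> B"
    using mem_localization_iff[OF B ideal_in_subringD(2)[OF max_spectrum_subringD(1)[OF B N'(1)]]]
    by blast
  note locM = mem_localization_iff[OF A_subring Mi(2)[OF M(1)]]
  \<comment> \<open>It remains to turn the denominator \<open>s \<in> B - N'\<close> of
    \<open>y\<close> into one from \<open>A - M\<close>. Here \<open>t\<close> and \<open>u\<close>
    clear the denominators of \<open>s\<close> and \<open>s \<otimes> y\<close>; if
    \<open>t \<otimes> s\<close> were in \<open>M\<close>, then \<open>s\<close> would be in
    \<open>N'\<close>.\<close>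
  obtain t where t: "t \<in> A - M" "t \<otimes> s \<in> A" using s(1) BM locM by blast
  obtain u where u: "u \<in> A - M" "u \<otimes> (s \<otimes> y) \<in> A" using s(3) BM locM by blast
  have ts: "t \<otimes> s \<in> A - M" using N'_mem[OF s(1) t(1)] s(2) t(2) by blast
  have c: "t \<in> carrier F" "s \<in> carrier F" "u \<in> carrier F"
    using t u s A_carr subringE(1)[OF B] by auto
  have "((t \<otimes> s) \<otimes> u) \<otimes> y = t \<otimes> (u \<otimes> (s \<otimes> y))" using c y(1) by algebra
  then have "((t \<otimes> s) \<otimes> u) \<otimes> y \<in> A" using t u subringE(6)[OF A_subring] by simp
  moreover have "(t \<otimes> s) \<otimes> u \<in> A - M"
    using primeideal_subringD[OF Mp[OF M(1)]] ts u(1) subringE(6)[OF A_subring] by blast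
  ultimately have "y \<in> localization F A M" using locM y(1) by blast
  then show False using M(3) by contradiction
qed

end

theorem corollary6p10:
  fixes A :: "'a set" and F :: "('a, 'b) ring_scheme"
  assumes "prufer_domain A F"
    and "A \<noteq> carrier F"
  shows "noetherian_space (max_topology (F\<lparr>carrier := A\<rparr>)) \<longleftrightarrow> double_sharp F A"
proof -
  interpret prufer_domain A F by fact
  show ?thesis
    using noetherian_imp_double_sharp double_sharp_imp_finitely_max_supported
      noetherian_max_topologyI[OF subring_cring[OF A_subring]] by blast
qed

end
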